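(* For each positive integer $n$, let $P_n$ be the Markov transition kernel on $\mathbb R^n$ (with its Borel $\sigma$-algebra) given by \[ P_n(x,\mathrm dy)\propto\exp\Big(-\tfrac23\big\|y-\tfrac x2\big\|^2\Big)\,\mathrm dy,\qquad x\in\mathbb R^n, \] where $\|\cdot\|$ is the Euclidean norm. Then $\rho^\dagger_{\mathrm{opt}}(P_n)\to1$ as $n\to\infty$.
   Context: An Mtk (Markov transition kernel) is a Markov transition kernel $P:\mathsf X\times\mathcal B\to[0,1]$ on a countably generated measurable space $(\mathsf X,\mathcal B)$. Write $Pf(x)=\int_{\mathsf X}P(x,\mathrm dy)f(y)$, $P^m$ for the $m$-step kernel, and $\delta_xP^m=P^m(x,\cdot)$. Total variation distance: $d_{\mathrm{TV}}(\mu,\nu)=\sup_{A\in\mathcal B}[\mu(A)-\nu(A)]$. If $P$ has stationary probability measure $\Pi$, its convergence rate is \[ \rho_*(P)=\exp\Big[\sup_{x\in\mathsf X}\limsup_{m\to\infty}\frac{\log d_{\mathrm{TV}}(\delta_xP^m,\Pi)}{m}\Big]\in[0,1] \] (with $\log 0=-\infty$, $\exp(-\infty)=0$). Let $\tilde T_0=[0,1)\times[0,\infty)\times(0,1]\times[0,\infty)$. $P$ satisfies (B1)-(B3) with parameter $(\eta,L,\varepsilon,d)\in\tilde T_0$ if there are a measurable $V:\mathsf X\to[0,\infty)$ and a probability measure $\nu$ on $\mathcal B$ such that: (B1) $PV(x)\le\eta V(x)+L$ for all $x\in\mathsf X$; (B2) $d>0$ and $P(x,A)\ge\varepsilon\nu(A)$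 for all $x\in C$, $A\in\mathcal B$, where $C=\{x\in\mathsf X:V(x)\le d\}$; (B3) $d>2L/(1-\eta)$. It is known that (B1)-(B3) imply that $P$ has a unique stationary distribution $\Pi$. Let $\tilde T(P)\subset\tilde T_0$ be the set of all parameters with which $P$ satisfies (B1)-(B3). Let $S_{\eta,L,\varepsilon,d}$ be the collection of all Mtks (on varying state spaces) satisfying (B1)-(B3) with parameter $(\eta,L,\varepsilon,d)$. (For set-theoretic reasons, the state spaces are taken from some fixed set of measurable spaces, which includes at least all finite sets of integers.) Define $\rho_{\mathrm{opt}}(\eta,L,\varepsilon,d)=\sup_{Q\in S_{\eta,L,\varepsilon,d}}\rho_*(Q)$ (equal to $0$ if $S_{\eta,L,\varepsilon,d}=\emptyset$), and \[ \rho^\dagger_{\mathrm{opt}}(P)=\inf_{(\eta,L,\varepsilon,d)\in\tilde T(P)}\rho_{\mathrm{opt}}(\eta,L,\varepsilon,d), \] set equal to $1$ if $\tilde T(P)=\emptyset$. (The stationary distribution of $P_n$ is the $n$-dimensional standard Gaussian.) *)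

theory Defs
  imports "HOL-Probability.Probability"
begin

definition countably_generated :: "'a measure \<Rightarrow> bool" where
  "countably_generated M \<longleftrightarrow>
     (\<exists>G. countable G \<and> G \<subseteq> Pow (space M) \<and> sets M = sigma_sets (space M) G)"

text \<open>
  A measurable space is represented by a value of type \<open>'a measure\<close> of which only \<open>space\<close> and
  \<open>sets\<close> matter. A kernel is a function into probability measures; its values outside
  \<open>space M\<close> are irrelevant. Measurability into \<open>prob_algebra M\<close> says that every
  \<open>K x\<close> is a probability measure on \<open>sets M\<close> and that \<open>\<lambda>x. K x A\<close> is measurable for all
  \<open>A \<in> sets M\<close>.
\<close>

definition markov_kernel :: "'a measure \<Rightarrow> ('a \<Rightarrow> 'a measure) \<Rightarrow> bool" where
  "markov_kernel M K \<longleftrightarrow> countably_generated M \<and> K \<in> M \<rightarrow>\<^sub>M prob_algebra M"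

primrec kernel_power ::
  "'a measure \<Rightarrow> ('a \<Rightarrow> 'a measure) \<Rightarrow> nat \<Rightarrow> 'a \<Rightarrow> 'a measure" where
  "kernel_power M K 0 = return M"
| "kernel_power M K (Suc m) = (\<lambda>x. kernel_power M K m x \<bind> K)"

definition stationary ::
  "'a measure \<Rightarrow> ('a \<Rightarrow> 'a measure) \<Rightarrow> 'a measure \<Rightarrow> bool" where
  "stationary M K \<mu> \<longleftrightarrow> prob_space \<mu> \<and> sets \<mu> = sets M \<and> \<mu> \<bind> K = \<mu>"

definition tv_dist :: "'a measure \<Rightarrow> 'a measure \<Rightarrow> 'a measure \<Rightarrow> real" where
  "tv_dist M \<mu> \<nu> = (SUP A\<in>sets M. measure \<mu> A - measure \<nu> A)"

text \<open>
  Logarithm and exponential with the conventions \<open>log 0 = -\<infinity>\<close> and \<open>exp (-\<infinity>) = 0\<close>;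
  the logarithm is only applied to nonnegative numbers.
\<close>

definition log_ext :: "real \<Rightarrow> ereal" where
  "log_ext t = (if t = 0 then -\<infinity> else ereal (ln t))"

definition exp_ext :: "ereal \<Rightarrow> ereal" where
  "exp_ext t = (if t = -\<infinity> then 0 else if t = \<infinity> then \<infinity> else ereal (exp (real_of_ereal t)))"

definition conv_rate ::
  "'a measure \<Rightarrow> ('a \<Rightarrow> 'a measure) \<Rightarrow> 'a measure \<Rightarrow> ereal" where
  "conv_rate M K \<mu> = exp_ext (SUP x\<in>space M.
     limsup (\<lambda>m. log_ext (tv_dist M (kernel_power M K m x) \<mu>) / ereal (real m)))"

type_synonym param = "real \<times> real \<times> real \<times> real"

definition T0 :: "param set" where
  "T0 = {0..<1} \<times> {0..} \<times> {0<..1} \<times> {0..}"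

definition drift_minor :: "'a measure \<Rightarrow> ('a \<Rightarrow> 'a measure) \<Rightarrow> param \<Rightarrow> bool" where
  "drift_minor M K = (\<lambda>(\<eta>, L, \<epsilon>, d). (\<eta>, L, \<epsilon>, d) \<in> T0 \<and>
     (\<exists>(V :: 'a \<Rightarrow> real) \<nu>.
        V \<in> borel_measurable M \<and> (\<forall>x\<in>space M. 0 \<le> V x) \<and>
        prob_space \<nu> \<and> sets \<nu> = sets M \<and>
        (\<forall>x\<in>space M. (\<integral>\<^sup>+ y. ennreal (V y) \<partial>K x) \<le> ennreal (\<eta> * V x + L)) \<and>
        d > 0 \<and>
        (\<forall>x\<in>{x \<in> space M. V x \<le> d}. \<forall>A\<in>sets M. measure (K x) A \<ge> \<epsilon> * measure \<nu> A) \<and>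
        d > 2 * L / (1 - \<eta>)))"

definition params :: "'a measure \<Rightarrow> ('a \<Rightarrow> 'a measure) \<Rightarrow> param set" where
  "params M K = {t. drift_minor M K t}"

text \<open>
  \<open>\<S>\<close> is the fixed set of admissible state spaces. A set of measurable spaces in the ordinary
  sense is given by subsets of the union of their carriers, which is the role of the type \<open>'s\<close>.
\<close>

definition kernels_with ::
  "'s measure set \<Rightarrow> param \<Rightarrow> ('s measure \<times> ('s \<Rightarrow> 's measure)) set" where
  "kernels_with \<S> t = {(M, K). M \<in> \<S> \<and> markov_kernel M K \<and> drift_minor M K t}"

text \<open>
  Every kernel in \<open>kernels_with \<S> t\<close> has exactly one stationary distribution, so
  \<open>\<mu>\<close> below is determined by \<open>(M, K)\<close>.
\<close>

definition rho_opt :: "'s measure set \<Rightarrow> param \<Rightarrow> ereal" where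
  "rho_opt \<S> t = (if kernels_with \<S> t = {} then 0
     else Sup {conv_rate M K \<mu> | M K \<mu>. (M, K) \<in> kernels_with \<S> t \<and> stationary M K \<mu>})"

definition rho_opt_dagger ::
  "'s measure set \<Rightarrow> 'a measure \<Rightarrow> ('a \<Rightarrow> 'a measure) \<Rightarrow> ereal" where
  "rho_opt_dagger \<S> M K =
     (if params M K = {} then 1 else (INF t\<in>params M K. rho_opt \<S> t))"

text \<open>
  \<open>\<real>\<^sup>n\<close> is represented by the extensional functions on \<open>{..<n}\<close>. Its Borel \<open>\<sigma>\<close>-algebra is the
  product of the Borel \<open>\<sigma>\<close>-algebras of the factors, and Lebesgue measure is the product measure.
\<close>

definition Rn_space :: "nat \<Rightarrow> (nat \<Rightarrow> real) measure" where
  "Rn_space n = PiM {..<n} (\<lambda>_. borel)"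

definition Rn_lebesgue :: "nat \<Rightarrow> (nat \<Rightarrow> real) measure" where
  "Rn_lebesgue n = PiM {..<n} (\<lambda>_. lborel)"

definition gauss_weight :: "nat \<Rightarrow> (nat \<Rightarrow> real) \<Rightarrow> (nat \<Rightarrow> real) \<Rightarrow> real" where
  "gauss_weight n x y = exp (- (2 / 3) * (L2_set (\<lambda>i. y i - x i / 2) {..<n})\<^sup>2)"

definition gauss_kernel :: "nat \<Rightarrow> (nat \<Rightarrow> real) \<Rightarrow> (nat \<Rightarrow> real) measure" where
  "gauss_kernel n x = density (Rn_lebesgue n)
     (\<lambda>y. ennreal (gauss_weight n x y) / (\<integral>\<^sup>+ z. ennreal (gauss_weight n x z) \<partial>Rn_lebesgue n))"

end

theory Submission
  imports Defs
begin

text \<open>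
  The rate that can be deduced from a parameter \<open>(\<eta>, L, \<epsilon>, d)\<close> is never better than
  \<open>1 - \<epsilon>\<close>, and in high dimension the Gaussian kernel only admits parameters with tiny \<open>\<epsilon>\<close>.

  The first claim (\<open>rho_opt_ge\<close>) comes from a chain on two states: one state is absorbing and
  the other is left with probability \<open>\<epsilon>\<close> at each step. With \<open>V = 0\<close> the drift condition is void
  and the small set is the whole space, so this chain satisfies the three conditions with every
  admissible parameter whose minorization constant is \<open>\<epsilon>\<close>. Its distance to stationarity from the
  transient state is \<open>(1 - \<epsilon>) ^ m\<close>.

  For the second claim (\<open>gauss_kernel_minorization_small\<close>), let \<open>C = {V \<le> d}\<close>. A point \<open>x\<close> that
  nearly minimizes \<open>V\<close> lies in \<open>C\<close>, and drift together with \<open>d > 2 L / (1 - \<eta>)\<close> makes the chain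
  started there stay in \<open>C\<close> for one step with probability above \<open>1 / 2\<close>
  (\<open>drift_returns_to_small_set\<close>). For every \<open>y \<in> C\<close> the transition laws from \<open>x\<close> and from \<open>y\<close>
  share the component \<open>\<epsilon> \<nu>\<close>, which bounds \<open>\<epsilon>\<close> by their Hellinger affinity
  (\<open>common_minorization_le_affinity\<close>); for these Gaussians the affinity is
  \<open>exp (- \<parallel>x - y\<parallel>\<^sup>2 / 24)\<close>. Integrating over \<open>y \<in> C\<close> against the transition law from
  \<open>x\<close> gives \<open>\<epsilon> / 2 \<le> E exp (- \<parallel>x - Y\<parallel>\<^sup>2 / 24)\<close>. The last expectation is a product of \<open>n\<close>
  one-dimensional ones, each at most \<open>sqrt (16 / 17)\<close>, so \<open>\<epsilon>\<close> decays exponentially in \<open>n\<close>.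
\<close>

section \<open>The extended logarithm and exponential\<close>

lemma log_ext_mono:
  assumes "0 \<le> s" "s \<le> t"
  shows "log_ext s \<le> log_ext t"
  using assms by (auto simp: log_ext_def)

lemma exp_ext_ereal [simp]: "exp_ext (ereal r) = ereal (exp r)"
  by (simp add: exp_ext_def)

lemma exp_ext_nonneg: "0 \<le> exp_ext t"
  by (cases t) (auto simp: exp_ext_def)

lemma exp_ext_mono:
  assumes "s \<le> t"
  shows "exp_ext s \<le> exp_ext t"
  using assms by (cases s; cases t) (auto simp: exp_ext_def)

section \<open>Convergence rates lie below one\<close>

lemma kernel_power_prob_algebra:
  assumes "K \<in> M \<rightarrow>\<^sub>M prob_algebra M"
  shows "kernel_power M K m \<in> M \<rightarrow>\<^sub>M prob_algebra M"
proof (induction m)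
  case 0
  then show ?case by (simp add: measurable_return_prob_space)
next
  case (Suc m)
  then show ?case using assms by (simp add: measurable_bind_prob_space)
qed

lemma tv_dist_bdd_above:
  assumes "prob_space \<mu>"
  shows "bdd_above ((\<lambda>A. measure \<mu> A - measure \<nu> A) ` sets M)"
proof (rule bdd_aboveI2)
  fix A
  have "measure \<mu> A \<le> 1" by (rule prob_space.prob_le_1[OF assms])
  then show "measure \<mu> A - measure \<nu> A \<le> 1"
    using measure_nonneg[of \<nu> A] by linarith
qed

lemma tv_dist_ge:
  assumes "prob_space \<mu>" "A \<in> sets M"
  shows "measure \<mu> A - measure \<nu> A \<le> tv_dist M \<mu> \<nu>"
  unfolding tv_dist_def using assms by (intro cSUP_upper tv_dist_bdd_above)

lemma tv_dist_nonneg: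
  assumes "prob_space \<mu>"
  shows "0 \<le> tv_dist M \<mu> \<nu>"
  using tv_dist_ge[OF assms, of "{}" M \<nu>] by simp

lemma tv_dist_le_1:
  assumes "prob_space \<mu>"
  shows "tv_dist M \<mu> \<nu> \<le> 1"
  unfolding tv_dist_def
proof (rule cSUP_least)
  fix A
  have "measure \<mu> A \<le> 1" by (rule prob_space.prob_le_1[OF assms])
  then show "measure \<mu> A - measure \<nu> A \<le> 1"
    using measure_nonneg[of \<nu> A] by linarith
qed auto

lemma conv_rate_le_1:
  assumes "K \<in> M \<rightarrow>\<^sub>M prob_algebra M"
  shows "conv_rate M K \<mu> \<le> 1"
proof -
  have "limsup (\<lambda>m. log_ext (tv_dist M (kernel_power M K m x) \<mu>) / ereal (real m)) \<le> 0"
    if x: "x \<in> space M" for x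
  proof (rule Limsup_bounded, rule eventually_sequentiallyI)
    fix m :: nat assume m: "1 \<le> m"
    have "prob_space (kernel_power M K m x)"
      using measurable_space[OF kernel_power_prob_algebra[OF assms] x]
      by (simp add: space_prob_algebra)
    then have "log_ext (tv_dist M (kernel_power M K m x) \<mu>) \<le> log_ext 1"
      by (intro log_ext_mono tv_dist_nonneg tv_dist_le_1)
    also have "log_ext 1 = 0" by (simp add: log_ext_def)
    finally show "log_ext (tv_dist M (kernel_power M K m x) \<mu>) / ereal (real m) \<le> 0"
      using m by (simp add: ereal_divide_le_pos)
  qed
  then have "conv_rate M K \<mu> \<le> exp_ext (ereal 0)"
    unfolding conv_rate_def zero_ereal_def by (intro exp_ext_mono SUP_least) auto
  then show ?thesis by (simp add: one_ereal_def)
qed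

text \<open>
  Total variation distance is at most one, so the exponents in the convergence rate are
  nonpositive for any kernel; this gives the trivial half of the limit.
\<close>

lemma rho_opt_le_1: "rho_opt \<S> t \<le> 1"
  by (auto simp: rho_opt_def kernels_with_def markov_kernel_def intro!: Sup_least conv_rate_le_1)

section \<open>A slow two-state chain\<close>

text \<open>
  From \<open>b\<close> a coin with success probability \<open>\<epsilon>\<close> decides whether to jump to the absorbing state
  \<open>a\<close>. The law is a push-forward into \<open>M\<close>, so that it lives on the
  \<open>\<sigma>\<close>-algebra of an arbitrarily given two-point space.
\<close>

definition absorbing_kernel :: "'a measure \<Rightarrow> 'a \<Rightarrow> 'a \<Rightarrow> real \<Rightarrow> 'a \<Rightarrow> 'a measure" where
  "absorbing_kernel M a b \<epsilon> x =
     (if x = b then distr (measure_pmf (bernoulli_pmf \<epsilon>)) M (\<lambda>h. if h then a else b)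
      else return M a)"

context
  fixes M :: "'a measure" and a b :: 'a and \<epsilon> :: real
  assumes space_M: "space M = {a, b}" and sets_M: "sets M = Pow {a, b}"
    and neq: "a \<noteq> b" and eps: "0 < \<epsilon>" "\<epsilon> \<le> 1"
begin

lemma absorbing_kernel_prob: "absorbing_kernel M a b \<epsilon> x \<in> space (prob_algebra M)"
  using space_M
  by (auto simp: absorbing_kernel_def space_prob_algebra prob_space_return
      intro!: prob_space.prob_space_distr measure_pmf.prob_space_axioms)

lemma absorbing_kernel_measurable: "absorbing_kernel M a b \<epsilon> \<in> M \<rightarrow>\<^sub>M prob_algebra M"
proof -
  have "sets M = sets (count_space {a, b})"
    using sets_M by simp
  then have "(M \<rightarrow>\<^sub>M prob_algebra M) = (count_space {a, b} \<rightarrow>\<^sub>M prob_algebra M)"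
    by (intro measurable_cong_sets) auto
  then show ?thesis
    using absorbing_kernel_prob by auto
qed

lemma absorbing_kernel_markov: "markov_kernel M (absorbing_kernel M a b \<epsilon>)"
  unfolding markov_kernel_def countably_generated_def
proof (intro conjI exI absorbing_kernel_measurable)
  show "countable (Pow {a, b})" by (simp add: countable_finite)
  show "Pow {a, b} \<subseteq> Pow (space M)" using space_M by simp
  show "sets M = sigma_sets (space M) (Pow {a, b})"
    using sets.sigma_sets_eq[of M] sets_M by simp
qed

lemma absorbing_kernel_stay:
  "emeasure (absorbing_kernel M a b \<epsilon> x) {b} = ennreal (1 - \<epsilon>) * indicator {b} x"
proof (cases "x = b")
  case True
  have "(\<lambda>h. if h then a else b) -` {b} \<inter> UNIV = {False}" using neq by auto
  then show ?thesis
    using True eps sets_M space_M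
    by (simp add: absorbing_kernel_def emeasure_distr emeasure_pmf_single)
next
  case False
  then show ?thesis
    using neq sets_M by (simp add: absorbing_kernel_def emeasure_return)
qed

text \<open>
  Since \<open>a\<close> is absorbing, the chain is still at \<open>b\<close> exactly when all \<open>m\<close> coins have failed.
\<close>

lemma absorbing_kernel_power_stay:
  "emeasure (kernel_power M (absorbing_kernel M a b \<epsilon>) m b) {b} = ennreal ((1 - \<epsilon>) ^ m)"
proof (induction m)
  case 0
  then show ?case using sets_M by (simp add: emeasure_return)
next
  case (Suc m)
  let ?K = "absorbing_kernel M a b \<epsilon>"
  have P: "kernel_power M ?K m b \<in> space (prob_algebra M)"
    using measurable_space[OF kernel_power_prob_algebra[OF absorbing_kernel_measurable]] space_M
    by auto
  then have S: "sets (kernel_power M ?K m b) = sets M"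
    by (simp add: space_prob_algebra)
  have "emeasure (kernel_power M ?K (Suc m) b) {b}
      = (\<integral>\<^sup>+x. ennreal (1 - \<epsilon>) * indicator {b} x \<partial>kernel_power M ?K m b)"
    using sets_M
    by (simp add: emeasure_bind_prob_algebra[OF P absorbing_kernel_measurable]
        absorbing_kernel_stay)
  also have "\<dots> = ennreal (1 - \<epsilon>) * emeasure (kernel_power M ?K m b) {b}"
    using S sets_M by (simp add: nn_integral_cmult_indicator)
  also have "\<dots> = ennreal ((1 - \<epsilon>) ^ Suc m)"
    using Suc eps by (simp add: ennreal_mult)
  finally show ?case .
qed

lemma absorbing_kernel_stationary:
  "stationary M (absorbing_kernel M a b \<epsilon>) (return M a)"
proof -
  have "return M a \<bind> absorbing_kernel M a b \<epsilon> = absorbing_kernel M a b \<epsilon> a"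
    using space_M measurable_prob_algebraD[OF absorbing_kernel_measurable]
    by (intro bind_return) auto
  then show ?thesis
    using neq space_M by (simp add: stationary_def absorbing_kernel_def prob_space_return)
qed

lemma absorbing_kernel_minorized:
  assumes "x \<in> space M" "A \<in> sets M"
  shows "\<epsilon> * measure (return M a) A \<le> measure (absorbing_kernel M a b \<epsilon> x) A"
proof (cases "x = b \<and> a \<in> A")
  case True
  have "\<epsilon> = measure (measure_pmf (bernoulli_pmf \<epsilon>)) {True}"
    using eps by (simp add: measure_pmf_single)
  also have "\<dots> \<le> measure (measure_pmf (bernoulli_pmf \<epsilon>)) ((\<lambda>h. if h then a else b) -` A)"
    using True by (intro measure_pmf.finite_measure_mono) auto
  also have "\<dots> = measure (absorbing_kernel M a b \<epsilon> x) A"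
    using True assms space_M by (simp add: absorbing_kernel_def measure_distr)
  finally show ?thesis
    using True assms by (simp add: measure_return)
next
  case False
  then show ?thesis
    using assms eps by (auto simp: absorbing_kernel_def measure_return split: split_indicator)
qed

text \<open>
  With \<open>V = 0\<close> the drift inequality reads \<open>0 \<le> L\<close> and the small set is everything. This is why
  \<open>\<eta>\<close>, \<open>L\<close> and \<open>d\<close> cannot improve on the rate \<open>1 - \<epsilon>\<close>.
\<close>

lemma absorbing_kernel_drift_minor:
  assumes "(\<eta>, L, \<epsilon>, d) \<in> T0" "0 < d" "2 * L / (1 - \<eta>) < d"
  shows "drift_minor M (absorbing_kernel M a b \<epsilon>) (\<eta>, L, \<epsilon>, d)"
proof -
  have "prob_space (return M a)"
    using space_M by (simp add: prob_space_return)
  then show ?thesis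
    unfolding drift_minor_def using assms absorbing_kernel_minorized
    by (auto intro!: exI[of _ "\<lambda>_. 0"] exI[of _ "return M a"] simp: T0_def)
qed

text \<open>
  The event \<open>{b}\<close> is null for the stationary law, so the distance at time \<open>m\<close> is at least the
  probability \<open>(1 - \<epsilon>) ^ m\<close> of not having left \<open>b\<close>.
\<close>

lemma absorbing_kernel_rate:
  "ereal (1 - \<epsilon>) \<le> conv_rate M (absorbing_kernel M a b \<epsilon>) (return M a)"
proof (cases "\<epsilon> = 1")
  \<comment> \<open>Here the logarithm of \<open>1 - \<epsilon>\<close> is minus infinity and the bound is trivial.\<close>
  case True
  then show ?thesis using exp_ext_nonneg by (simp add: conv_rate_def zero_ereal_def)
next
  case False
  then have e: "0 < 1 - \<epsilon>" using eps by simp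
  let ?P = "kernel_power M (absorbing_kernel M a b \<epsilon>)"
  let ?l = "\<lambda>x m. log_ext (tv_dist M (?P m x) (return M a)) / ereal (real m)"
  have "ereal (ln (1 - \<epsilon>)) \<le> limsup (?l b)"
  proof (rule le_Limsup, simp, rule eventually_sequentiallyI)
    fix m :: nat assume m: "1 \<le> m"
    have "prob_space (?P m b)"
      using measurable_space[OF kernel_power_prob_algebra[OF absorbing_kernel_measurable], of b m]
        space_M by (simp add: space_prob_algebra)
    then have "measure (?P m b) {b} - measure (return M a) {b} \<le> tv_dist M (?P m b) (return M a)"
      using sets_M by (intro tv_dist_ge) auto
    moreover have "measure (?P m b) {b} = (1 - \<epsilon>) ^ m"
      using absorbing_kernel_power_stay[of m] e by (simp add: measure_def)
    moreover have "measure (return M a) {b} = 0"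
      using neq sets_M by (simp add: measure_return)
    ultimately have "log_ext ((1 - \<epsilon>) ^ m) \<le> log_ext (tv_dist M (?P m b) (return M a))"
      using e by (intro log_ext_mono) auto
    moreover have "log_ext ((1 - \<epsilon>) ^ m) = ereal (real m * ln (1 - \<epsilon>))"
      using e by (simp add: log_ext_def ln_realpow)
    ultimately have "ereal (real m * ln (1 - \<epsilon>)) / ereal (real m) \<le> ?l b m"
      using m by (intro ereal_divide_right_mono) auto
    then show "ereal (ln (1 - \<epsilon>)) \<le> ?l b m"
      using m by simp
  qed
  also have "\<dots> \<le> (SUP x\<in>space M. limsup (?l x))"
    using space_M by (intro SUP_upper) auto
  finally have "exp_ext (ereal (ln (1 - \<epsilon>))) \<le> conv_rate M (absorbing_kernel M a b \<epsilon>) (return M a)"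
    unfolding conv_rate_def by (rule exp_ext_mono)
  then show ?thesis using e by simp
qed

end

lemma rho_opt_ge:
  fixes \<S> :: "'s measure set"
  assumes "M \<in> \<S>" "space M = {a, b}" "sets M = Pow {a, b}" "a \<noteq> b"
    and t: "(\<eta>, L, \<epsilon>, d) \<in> T0" "0 < d" "2 * L / (1 - \<eta>) < d"
  shows "ereal (1 - \<epsilon>) \<le> rho_opt \<S> (\<eta>, L, \<epsilon>, d)"
proof -
  let ?K = "absorbing_kernel M a b \<epsilon>"
  have eps: "0 < \<epsilon>" "\<epsilon> \<le> 1" using t by (auto simp: T0_def)
  note chain = assms(2-4) eps
  have mem: "(M, ?K) \<in> kernels_with \<S> (\<eta>, L, \<epsilon>, d)"
    using assms(1) absorbing_kernel_markov[OF chain] absorbing_kernel_drift_minor[OF chain t]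
    by (simp add: kernels_with_def)
  have "ereal (1 - \<epsilon>) \<le> conv_rate M ?K (return M a)"
    by (rule absorbing_kernel_rate[OF chain])
  also have "\<dots> \<le> Sup {conv_rate M K \<mu> | M K \<mu>.
      (M, K) \<in> kernels_with \<S> (\<eta>, L, \<epsilon>, d) \<and> stationary M K \<mu>}"
    using mem absorbing_kernel_stationary[OF chain] by (intro Sup_upper) blast
  also have "\<dots> = rho_opt \<S> (\<eta>, L, \<epsilon>, d)"
    using mem by (auto simp: rho_opt_def)
  finally show ?thesis .
qed

section \<open>What drift and minorization force\<close>

text \<open>
  Let \<open>v\<close> be the infimum of \<open>V\<close>. A mean of \<open>V\<close> is at least \<open>v\<close>, so drift gives
  \<open>v \<le> \<eta> v + L\<close>, that is \<open>v \<le> L / (1 - \<eta>) < d / 2\<close>. From a point where \<open>V\<close> is close to \<open>v\<close>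
  the mean of \<open>V\<close> after one step is therefore still below \<open>d / 2\<close>, and Markov's inequality bounds
  the probability of leaving \<open>{V \<le> d}\<close>. Working at such a point avoids any appeal to the stationary
  law, for which integrability of \<open>V\<close> would have to be established.
\<close>

lemma drift_returns_to_small_set:
  fixes V :: "'a \<Rightarrow> real"
  assumes ne: "space M \<noteq> {}"
    and K: "\<And>x. x \<in> space M \<Longrightarrow> prob_space (K x)" "\<And>x. x \<in> space M \<Longrightarrow> sets (K x) = sets M"
    and V: "V \<in> borel_measurable M" "\<And>x. x \<in> space M \<Longrightarrow> 0 \<le> V x"
    and drift: "\<And>x. x \<in> space M \<Longrightarrow> (\<integral>\<^sup>+ y. ennreal (V y) \<partial>K x) \<le> ennreal (\<eta> * V x + L)"
    and par: "0 \<le> \<eta>" "\<eta> < 1" "0 \<le> L" "0 < d" "2 * L / (1 - \<eta>) < d"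
  obtains x where "x \<in> space M" "V x \<le> d" "1 / 2 < measure (K x) {y \<in> space M. V y \<le> d}"
proof -
  define v where "v = (INF x\<in>space M. V x)"
  have bdd: "bdd_below (V ` space M)" using V(2) by (rule bdd_belowI2)
  have v_le: "v \<le> V x" if "x \<in> space M" for x
    unfolding v_def by (rule cINF_lower[OF bdd that])
  have v_drift: "v \<le> \<eta> * V x + L" if x: "x \<in> space M" for x
  proof -
    interpret prob_space "K x" by (rule K(1)[OF x])
    have "ennreal v = (\<integral>\<^sup>+ y. ennreal v \<partial>K x)" by (simp add: emeasure_space_1)
    also have "\<dots> \<le> (\<integral>\<^sup>+ y. ennreal (V y) \<partial>K x)"
      using sets_eq_imp_space_eq[OF K(2)[OF x]] v_le
      by (intro nn_integral_mono ennreal_leI) auto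
    also note drift[OF x]
    finally show ?thesis using par V(2)[OF x] by (subst (asm) ennreal_le_iff) auto
  qed
  \<comment> \<open>The slack is chosen so that a point within \<open>e\<close> of the infimum has \<open>\<eta> V x + L < d / 2\<close>.\<close>
  define e where "e = (1 - \<eta>) * d / 2 - L"
  have e: "0 < e" using par by (simp add: e_def field_simps)
  obtain x where x: "x \<in> space M" "V x < v + e"
    using cINF_less_iff[OF ne bdd, of "v + e"] e by (auto simp: v_def)
  have "(1 - \<eta>) * V x < L + e"
    using v_drift[OF x(1)] x(2) by (simp add: left_diff_distrib)
  also have "L + e = (1 - \<eta>) * (d / 2)" by (simp add: e_def)
  finally have Vx: "V x < d / 2" using par by simp
  have "\<eta> * V x \<le> \<eta> * (d / 2)" using par Vx by (intro mult_left_mono) auto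
  then have small: "\<eta> * V x + L < d / 2" using e by (simp add: e_def algebra_simps)
  interpret prob_space "K x" by (rule K(1)[OF x(1)])
  have [measurable_cong]: "sets (K x) = sets M" by (rule K(2)[OF x(1)])
  have [simp]: "space (K x) = space M" by (rule sets_eq_imp_space_eq) fact
  note V(1)[measurable]
  let ?D = "{y \<in> space M. d < V y}"
  have "ennreal (d * prob ?D) = (\<integral>\<^sup>+ y. ennreal d * indicator ?D y \<partial>K x)"
    using par by (simp add: nn_integral_cmult_indicator emeasure_eq_measure ennreal_mult)
  also have "\<dots> \<le> (\<integral>\<^sup>+ y. ennreal (V y) \<partial>K x)"
    by (intro nn_integral_mono) (auto split: split_indicator intro: ennreal_leI)
  also note drift[OF x(1)]
  finally have "d * prob ?D \<le> \<eta> * V x + L"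
    using par V(2)[OF x(1)] by (subst (asm) ennreal_le_iff) auto
  then have "d * prob ?D < d * (1 / 2)" using small by simp
  then have "prob ?D < 1 / 2" using par by (simp only: mult_less_cancel_left_pos)
  moreover have "prob {y \<in> space M. V y \<le> d} = 1 - prob ?D"
    using prob_neg[of "\<lambda>y. d < V y"] by (simp add: not_less)
  ultimately have "1 / 2 < prob {y \<in> space M. V y \<le> d}" by simp
  then show thesis using that[OF x(1)] Vx par by simp
qed

text \<open>
  Testing the first minorization on \<open>{p \<le> q}\<close> and the second on its complement bounds \<open>\<epsilon>\<close> by
  the integral of \<open>min p q\<close>, the overlap of the two laws. The geometric mean is larger than the
  minimum but, unlike it, has a closed-form integral for Gaussian densities.
\<close>

lemma common_minorization_le_affinity:
  fixes p q :: "'a \<Rightarrow> real"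
  assumes meas: "p \<in> borel_measurable N" "q \<in> borel_measurable N"
    and nonneg: "\<And>z. 0 \<le> p z" "\<And>z. 0 \<le> q z"
    and fin: "finite_measure (density N p)" "finite_measure (density N q)"
    and \<nu>: "prob_space \<nu>" "sets \<nu> = sets N"
    and minor: "\<And>A. A \<in> sets N \<Longrightarrow> \<epsilon> * measure \<nu> A \<le> measure (density N p) A"
      "\<And>A. A \<in> sets N \<Longrightarrow> \<epsilon> * measure \<nu> A \<le> measure (density N q) A"
  shows "ennreal \<epsilon> \<le> (\<integral>\<^sup>+ z. ennreal (sqrt (p z * q z)) \<partial>N)"
proof -
  note meas[measurable]
  interpret p: finite_measure "density N p" by fact
  interpret q: finite_measure "density N q" by fact
  interpret \<nu>: prob_space \<nu> by fact
  have [simp]: "space \<nu> = space N" using \<nu>(2) by (rule sets_eq_imp_space_eq)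
  have [measurable_cong]: "sets \<nu> = sets N" by fact
  let ?A = "{z \<in> space N. p z \<le> q z}" and ?B = "{z \<in> space N. \<not> p z \<le> q z}"
  have [measurable]: "?A \<in> sets N" "?B \<in> sets N" by measurable
  have "\<nu>.prob ?B = 1 - \<nu>.prob ?A"
    using \<nu>.prob_neg[of "\<lambda>z. p z \<le> q z"] by simp
  then have "\<epsilon> = \<epsilon> * \<nu>.prob ?A + \<epsilon> * \<nu>.prob ?B"
    by (simp only: right_diff_distrib)
  also have "\<dots> \<le> measure (density N p) ?A + measure (density N q) ?B"
    by (intro add_mono minor) measurable
  finally have "ennreal \<epsilon> \<le> emeasure (density N p) ?A + emeasure (density N q) ?B"
    by (simp add: p.emeasure_eq_measure q.emeasure_eq_measure flip: ennreal_plus)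
  also have "\<dots> = (\<integral>\<^sup>+ z. ennreal (p z) * indicator ?A z + ennreal (q z) * indicator ?B z \<partial>N)"
    by (simp add: emeasure_density nn_integral_add)
  also have "\<dots> \<le> (\<integral>\<^sup>+ z. ennreal (sqrt (p z * q z)) \<partial>N)"
  proof (rule nn_integral_mono)
    fix z assume z: "z \<in> space N"
    have "p z \<le> sqrt (p z * q z)" if "p z \<le> q z"
      using that nonneg by (intro real_le_rsqrt) (auto simp: power2_eq_square intro: mult_left_mono)
    moreover have "q z \<le> sqrt (p z * q z)" if "\<not> p z \<le> q z"
      using that nonneg by (intro real_le_rsqrt) (auto simp: power2_eq_square intro: mult_right_mono)
    ultimately show "ennreal (p z) * indicator ?A z + ennreal (q z) * indicator ?B z
        \<le> ennreal (sqrt (p z * q z))"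
      using z by (cases "p z \<le> q z") (auto simp: ennreal_leI)
  qed
  finally show ?thesis .
qed

section \<open>Gaussian integrals\<close>

definition sqdist :: "nat \<Rightarrow> (nat \<Rightarrow> real) \<Rightarrow> (nat \<Rightarrow> real) \<Rightarrow> real" where
  "sqdist n x y = (\<Sum>i<n. (x i - y i)\<^sup>2)"

lemma sqdist_measurable [measurable]: "(\<lambda>y. sqdist n y c) \<in> borel_measurable (Rn_lebesgue n)"
  unfolding sqdist_def Rn_lebesgue_def by measurable

text \<open>
  The centre \<open>c\<close> is kept general because completing squares below moves it, while the value of
  the integral depends only on the width.
\<close>

lemma nn_integral_gaussian_1d:
  assumes "0 < \<gamma>"
  shows "(\<integral>\<^sup>+ y. ennreal (exp (- \<gamma> * (y - c)\<^sup>2)) \<partial>lborel) = ennreal (sqrt (pi / \<gamma>))"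
proof -
  define s where "s = sqrt (1 / (2 * \<gamma>))"
  have s: "0 < s" "s\<^sup>2 = 1 / (2 * \<gamma>)" using assms by (auto simp: s_def)
  have "exp (- \<gamma> * (y - c)\<^sup>2) = sqrt (pi / \<gamma>) * normal_density c s y" for y
    using assms by (simp add: normal_density_def s(2) real_sqrt_divide)
  then have "(\<integral>\<^sup>+ y. ennreal (exp (- \<gamma> * (y - c)\<^sup>2)) \<partial>lborel)
      = (\<integral>\<^sup>+ y. ennreal (sqrt (pi / \<gamma>)) * ennreal (normal_density c s y) \<partial>lborel)"
    using assms by (simp add: ennreal_mult)
  also have "\<dots> = ennreal (sqrt (pi / \<gamma>)) * emeasure (density lborel (normal_density c s)) UNIV"
    by (simp add: nn_integral_cmult emeasure_density)
  also have "emeasure (density lborel (normal_density c s)) UNIV = 1"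
    using prob_space.emeasure_space_1[OF prob_space_normal_density[OF s(1), of c]] by simp
  finally show ?thesis by simp
qed

lemma nn_integral_gaussian:
  assumes "0 < \<gamma>"
  shows "(\<integral>\<^sup>+ y. ennreal (exp (- \<gamma> * sqdist n y c)) \<partial>Rn_lebesgue n) = ennreal (sqrt (pi / \<gamma>) ^ n)"
proof -
  interpret product_sigma_finite "\<lambda>_::nat. lborel :: real measure" by standard
  have "(\<integral>\<^sup>+ y. ennreal (exp (- \<gamma> * sqdist n y c)) \<partial>Rn_lebesgue n)
      = (\<integral>\<^sup>+ y. (\<Prod>i<n. ennreal (exp (- \<gamma> * (y i - c i)\<^sup>2))) \<partial>PiM {..<n} (\<lambda>_. lborel))"
    unfolding Rn_lebesgue_def sqdist_def
    by (intro nn_integral_cong)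
      (simp add: sum_distrib_left exp_sum prod_ennreal flip: sum_negf)
  also have "\<dots> = (\<Prod>i<n. \<integral>\<^sup>+ y. ennreal (exp (- \<gamma> * (y - c i)\<^sup>2)) \<partial>lborel)"
    by (rule product_nn_integral_prod) auto
  also have "\<dots> = ennreal (sqrt (pi / \<gamma>) ^ n)"
    using assms by (simp only: nn_integral_gaussian_1d prod_constant) (simp add: ennreal_power)
  finally show ?thesis .
qed

text \<open>
  The exponent \<open>2 / 3\<close> corresponds to variance \<open>3 / 4\<close> in each coordinate. The normalizing
  constant does not depend on \<open>x\<close>; its base \<open>pi / (2 / 3)\<close> is left unsimplified to match
  \<open>nn_integral_gaussian\<close>.
\<close>

definition gauss_density :: "nat \<Rightarrow> (nat \<Rightarrow> real) \<Rightarrow> (nat \<Rightarrow> real) \<Rightarrow> real" where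
  "gauss_density n x y = exp (- (2 / 3) * sqdist n y (\<lambda>i. x i / 2)) / sqrt (pi / (2 / 3)) ^ n"

lemma gauss_weight_sqdist: "gauss_weight n x y = exp (- (2 / 3) * sqdist n y (\<lambda>i. x i / 2))"
  by (simp add: gauss_weight_def sqdist_def L2_set_def sum_nonneg)

lemma gauss_kernel_density:
  "gauss_kernel n x = density (Rn_lebesgue n) (\<lambda>y. ennreal (gauss_density n x y))"
  using nn_integral_gaussian[of "2 / 3" n "\<lambda>i. x i / 2"]
  by (simp add: gauss_kernel_def gauss_weight_sqdist gauss_density_def divide_ennreal)

lemma gauss_density_nonneg: "0 \<le> gauss_density n x y"
  by (simp add: gauss_density_def)

lemma gauss_density_measurable [measurable]:
  "gauss_density n x \<in> borel_measurable (Rn_lebesgue n)"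
  unfolding gauss_density_def[abs_def] by measurable

lemma sets_gauss_kernel: "sets (gauss_kernel n x) = sets (Rn_space n)"
  by (auto simp: gauss_kernel_def Rn_lebesgue_def Rn_space_def intro!: sets_PiM_cong)

lemma prob_space_gauss_kernel: "prob_space (gauss_kernel n x)"
proof
  have "emeasure (gauss_kernel n x) (space (gauss_kernel n x))
      = (\<integral>\<^sup>+ y. ennreal (gauss_density n x y) \<partial>Rn_lebesgue n)"
    by (simp add: gauss_kernel_density emeasure_density
        cong: nn_integral_cong)
  also have "\<dots> = (\<integral>\<^sup>+ y. ennreal (1 / sqrt (pi / (2 / 3)) ^ n)
      * ennreal (exp (- (2 / 3) * sqdist n y (\<lambda>i. x i / 2))) \<partial>Rn_lebesgue n)"
    by (simp add: gauss_density_def flip: ennreal_mult)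
  also have "\<dots> = ennreal (1 / sqrt (pi / (2 / 3)) ^ n) * ennreal (sqrt (pi / (2 / 3)) ^ n)"
    by (subst nn_integral_cmult) (simp_all only: nn_integral_gaussian, measurable)
  also have "\<dots> = 1" by (simp flip: ennreal_mult)
  finally show "emeasure (gauss_kernel n x) (space (gauss_kernel n x)) = 1" .
qed

text \<open>
  By the parallelogram law the geometric mean of two Gaussian densities of equal width is, up to a
  factor depending on the distance of their centres, the density at the midpoint. The centres are
  \<open>x / 2\<close> and \<open>y / 2\<close>, hence the midpoint is the centre belonging to \<open>(x + y) / 2\<close>.
\<close>

lemma gauss_affinity:
  "(\<integral>\<^sup>+ z. ennreal (sqrt (gauss_density n x z * gauss_density n y z)) \<partial>Rn_lebesgue n)
    = ennreal (exp (- sqdist n y x / 24))"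
proof -
  let ?m = "\<lambda>i. (x i + y i) / 2"
  let ?Z = "sqrt (pi / (2 / 3)) ^ n"
  have split: "sqdist n z (\<lambda>i. x i / 2) + sqdist n z (\<lambda>i. y i / 2)
      = 2 * sqdist n z (\<lambda>i. ?m i / 2) + sqdist n y x / 8" for z
    unfolding sqdist_def sum_distrib_left sum_divide_distrib sum.distrib[symmetric]
    by (intro sum.cong) (simp_all add: power2_eq_square field_simps)
  have "sqrt (gauss_density n x z * gauss_density n y z)
      = exp (- sqdist n y x / 24) * gauss_density n ?m z" for z
  proof (rule real_sqrt_unique)
    have "gauss_density n x z * gauss_density n y z
        = exp (- (2 / 3) * (sqdist n z (\<lambda>i. x i / 2) + sqdist n z (\<lambda>i. y i / 2))) / ?Z\<^sup>2"
      by (simp add: gauss_density_def power2_eq_square distrib_left exp_add[symmetric])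
    also have "\<dots> = (exp (- sqdist n y x / 24) * gauss_density n ?m z)\<^sup>2"
      unfolding split gauss_density_def
      by (simp add: power_mult_distrib power_divide algebra_simps flip: exp_double exp_add)
    finally show "(exp (- sqdist n y x / 24) * gauss_density n ?m z)\<^sup>2
        = gauss_density n x z * gauss_density n y z" by simp
  qed (simp add: gauss_density_nonneg)
  then have "(\<integral>\<^sup>+ z. ennreal (sqrt (gauss_density n x z * gauss_density n y z)) \<partial>Rn_lebesgue n)
      = ennreal (exp (- sqdist n y x / 24)) * (\<integral>\<^sup>+ z. ennreal (gauss_density n ?m z) \<partial>Rn_lebesgue n)"
    by (simp add: ennreal_mult gauss_density_nonneg nn_integral_cmult)
  also have "(\<integral>\<^sup>+ z. ennreal (gauss_density n ?m z) \<partial>Rn_lebesgue n) = 1"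
    using prob_space.emeasure_space_1[OF prob_space_gauss_kernel[of n ?m]]
    by (simp add: gauss_kernel_density emeasure_density cong: nn_integral_cong)
  finally show ?thesis by simp
qed

text \<open>
  Completing the square, \<open>2/3 (b - a/2)\<^sup>2 + 1/24 (b - a)\<^sup>2 = 17/24 (b - 9a/17)\<^sup>2 + a\<^sup>2 / 102\<close>.
  The remainder is nonnegative, so dropping it yields a bound that is uniform in \<open>x\<close>; narrowing
  the Gaussian from \<open>2/3 = 16/24\<close> to \<open>17/24\<close> brings in a factor \<open>sqrt (16 / 17)\<close> per coordinate.
\<close>

lemma gauss_kernel_mean_affinity:
  "(\<integral>\<^sup>+ y. ennreal (exp (- sqdist n y x / 24)) \<partial>gauss_kernel n x) \<le> ennreal (sqrt (16 / 17) ^ n)"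
proof -
  let ?Z = "sqrt (pi / (2 / 3)) ^ n" and ?c = "\<lambda>i. 9 * x i / 17"
  have quad: "17 / 24 * sqdist n y ?c \<le> 2 / 3 * sqdist n y (\<lambda>i. x i / 2) + sqdist n y x / 24" for y
  proof -
    have "17 / 24 * (b - 9 * a / 17)\<^sup>2 + a\<^sup>2 / 102 = 2 / 3 * (b - a / 2)\<^sup>2 + (b - a)\<^sup>2 / 24"
      for a b :: real
      by (simp add: power2_eq_square field_simps)
    then have "17 / 24 * (b - 9 * a / 17)\<^sup>2 \<le> 2 / 3 * (b - a / 2)\<^sup>2 + (b - a)\<^sup>2 / 24"
      for a b :: real
      by (smt (verit) zero_le_power2 divide_nonneg_pos)
    then show ?thesis
      unfolding sqdist_def sum_distrib_left sum_divide_distrib sum.distrib[symmetric]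
      by (intro sum_mono)
  qed
  have "(\<integral>\<^sup>+ y. ennreal (exp (- sqdist n y x / 24)) \<partial>gauss_kernel n x)
      = (\<integral>\<^sup>+ y. ennreal (gauss_density n x y * exp (- sqdist n y x / 24)) \<partial>Rn_lebesgue n)"
    by (simp add: gauss_kernel_density nn_integral_density ennreal_mult gauss_density_nonneg)
  also have "\<dots> \<le> (\<integral>\<^sup>+ y. ennreal (1 / ?Z) * ennreal (exp (- (17 / 24) * sqdist n y ?c)) \<partial>Rn_lebesgue n)"
  proof (rule nn_integral_mono)
    fix y
    have "gauss_density n x y * exp (- sqdist n y x / 24)
        = 1 / ?Z * exp (- (2 / 3 * sqdist n y (\<lambda>i. x i / 2) + sqdist n y x / 24))"
      by (simp add: gauss_density_def flip: exp_add)
    also have "\<dots> \<le> 1 / ?Z * exp (- (17 / 24) * sqdist n y ?c)"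
      using quad[of y] by (intro mult_left_mono) auto
    finally show "ennreal (gauss_density n x y * exp (- sqdist n y x / 24))
        \<le> ennreal (1 / ?Z) * ennreal (exp (- (17 / 24) * sqdist n y ?c))"
      by (simp add: ennreal_leI flip: ennreal_mult)
  qed
  also have "\<dots> = ennreal (1 / ?Z) * ennreal (sqrt (pi / (17 / 24)) ^ n)"
    by (subst nn_integral_cmult) (simp_all only: nn_integral_gaussian, measurable)
  also have "\<dots> = ennreal ((sqrt (pi / (17 / 24)) / sqrt (pi / (2 / 3))) ^ n)"
    by (simp add: power_divide flip: ennreal_mult)
  also have "sqrt (pi / (17 / 24)) / sqrt (pi / (2 / 3)) = sqrt (16 / 17)"
    by (simp flip: real_sqrt_divide)
  finally show ?thesis .
qed

section \<open>Small sets in high dimension\<close>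

text \<open>
  The small set \<open>C\<close> carries mass above one half under the law from some \<open>x \<in> C\<close>, yet in high
  dimension that law is spread over distances of order \<open>sqrt n\<close> from \<open>x\<close>. So \<open>C\<close> contains
  points far from \<open>x\<close>, whose transition laws barely overlap with that of \<open>x\<close>. Averaging the
  affinity over \<open>C\<close> makes this quantitative without choosing a radius.
\<close>

lemma gauss_kernel_minorization_small:
  assumes "(\<eta>, L, \<epsilon>, d) \<in> params (Rn_space n) (gauss_kernel n)"
  shows "\<epsilon> \<le> 2 * sqrt (16 / 17) ^ n"
proof -
  let ?M = "Rn_space n" and ?K = "gauss_kernel n" and ?N = "Rn_lebesgue n"
  from assms obtain V :: "(nat \<Rightarrow> real) \<Rightarrow> real" and \<nu> where
    t: "(\<eta>, L, \<epsilon>, d) \<in> T0"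
    and V: "V \<in> borel_measurable ?M" "\<And>x. x \<in> space ?M \<Longrightarrow> 0 \<le> V x"
    and \<nu>: "prob_space \<nu>" "sets \<nu> = sets ?M"
    and drift: "\<And>x. x \<in> space ?M \<Longrightarrow> (\<integral>\<^sup>+ y. ennreal (V y) \<partial>?K x) \<le> ennreal (\<eta> * V x + L)"
    and d: "0 < d" "2 * L / (1 - \<eta>) < d"
    and minor: "\<And>x A. x \<in> space ?M \<Longrightarrow> V x \<le> d \<Longrightarrow> A \<in> sets ?M \<Longrightarrow>
      \<epsilon> * measure \<nu> A \<le> measure (?K x) A"
    by (auto simp: params_def drift_minor_def)
  have par: "0 \<le> \<eta>" "\<eta> < 1" "0 \<le> L" "0 < \<epsilon>" using t by (auto simp: T0_def)
  have ne: "space ?M \<noteq> {}" by (simp add: Rn_space_def space_PiM PiE_eq_empty_iff)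
  obtain x where x: "x \<in> space ?M" "V x \<le> d"
    and half: "1 / 2 < measure (?K x) {y \<in> space ?M. V y \<le> d}"
    using drift_returns_to_small_set[of ?M ?K V \<eta> L d, OF ne prob_space_gauss_kernel
        sets_gauss_kernel V drift par(1-3) d] by blast
  let ?C = "{y \<in> space ?M. V y \<le> d}"
  interpret x: prob_space "?K x" by (rule prob_space_gauss_kernel)
  have sets_N: "sets ?N = sets ?M"
    using sets_gauss_kernel[of n x] by (simp add: gauss_kernel_density)
  have C: "?C \<in> sets (?K x)"
    using V(1) unfolding sets_gauss_kernel by measurable
  have close: "ennreal \<epsilon> \<le> ennreal (exp (- sqdist n y x / 24))" if y: "y \<in> ?C" for y
  proof -
    have "ennreal \<epsilon> \<le> (\<integral>\<^sup>+ z. ennreal (sqrt (gauss_density n x z * gauss_density n y z)) \<partial>?N)"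
      using x y minor[of x] minor[of y] \<nu> sets_N
        prob_space.finite_measure[OF prob_space_gauss_kernel]
      by (intro common_minorization_le_affinity[where \<nu> = \<nu>])
        (simp_all add: gauss_density_nonneg flip: gauss_kernel_density)
    then show ?thesis by (simp add: gauss_affinity)
  qed
  have "ennreal (\<epsilon> * measure (?K x) ?C) = (\<integral>\<^sup>+ y. ennreal \<epsilon> * indicator ?C y \<partial>?K x)"
    using C par by (simp add: nn_integral_cmult_indicator x.emeasure_eq_measure ennreal_mult)
  also have "\<dots> \<le> (\<integral>\<^sup>+ y. ennreal (exp (- sqdist n y x / 24)) \<partial>?K x)"
    using close by (intro nn_integral_mono) (auto split: split_indicator)
  also note gauss_kernel_mean_affinity
  finally have "\<epsilon> * measure (?K x) ?C \<le> sqrt (16 / 17) ^ n"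
    by (simp add: ennreal_le_iff)
  moreover have "\<epsilon> * (1 / 2) \<le> \<epsilon> * measure (?K x) ?C"
    using half par by (intro mult_left_mono) auto
  ultimately show ?thesis by simp
qed

theorem proposition21:
  fixes \<S> :: "'s measure set" and emb :: "int \<Rightarrow> 's"
  assumes "inj emb"
    and "\<And>F. finite F \<Longrightarrow> F \<noteq> {} \<Longrightarrow>
           \<exists>M\<in>\<S>. space M = emb ` F \<and> sets M = Pow (emb ` F)"
  shows "(\<lambda>n. rho_opt_dagger \<S> (Rn_space n) (gauss_kernel n)) \<longlonglongrightarrow> 1"
proof -
  let ?\<rho> = "\<lambda>n. rho_opt_dagger \<S> (Rn_space n) (gauss_kernel n)"
  let ?P = "\<lambda>n. params (Rn_space n) (gauss_kernel n)"
  obtain M where M: "M \<in> \<S>" "space M = {emb 0, emb 1}" "sets M = Pow {emb 0, emb 1}"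
    using assms(2)[of "{0, 1}"] by auto
  have neq: "emb 0 \<noteq> emb 1" using assms(1) by (simp add: inj_eq)
  have upper: "?\<rho> n \<le> 1" for n
    by (auto simp: rho_opt_dagger_def intro: INF_lower2 rho_opt_le_1)
  have lower: "ereal (1 - 2 * sqrt (16 / 17) ^ n) \<le> ?\<rho> n" for n
  proof (cases "?P n = {}")
    case True
    then show ?thesis by (simp add: rho_opt_dagger_def one_ereal_def)
  next
    case False
    have "ereal (1 - 2 * sqrt (16 / 17) ^ n) \<le> rho_opt \<S> t" if "t \<in> ?P n" for t
    proof -
      obtain \<eta> L \<epsilon> d where t: "t = (\<eta>, L, \<epsilon>, d)" by (cases t)
      have "ereal (1 - 2 * sqrt (16 / 17) ^ n) \<le> ereal (1 - \<epsilon>)"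
        using gauss_kernel_minorization_small that t by simp
      also have "\<dots> \<le> rho_opt \<S> (\<eta>, L, \<epsilon>, d)"
        using that by (intro rho_opt_ge[OF M neq]) (auto simp: t params_def drift_minor_def)
      finally show ?thesis by (simp add: t)
    qed
    then show ?thesis using False by (auto simp: rho_opt_dagger_def intro: INF_greatest)
  qed
  have "(\<lambda>n. sqrt (16 / 17) ^ n) \<longlonglongrightarrow> 0"
    using real_sqrt_less_mono[of "16 / 17" 1] by (intro LIMSEQ_realpow_zero) simp_all
  then have "(\<lambda>n. 1 - 2 * sqrt (16 / 17) ^ n) \<longlonglongrightarrow> 1 - 2 * (0::real)"
    by (intro tendsto_diff tendsto_mult tendsto_const)
  then have "(\<lambda>n. ereal (1 - 2 * sqrt (16 / 17) ^ n)) \<longlonglongrightarrow> 1"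
    by (simp add: one_ereal_def)
  from tendsto_sandwich[OF _ _ this tendsto_const] show ?thesis
    by (simp add: lower upper)
qed

end
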